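(* Let $K$ be a triangle with vertices $\bm v^{(1)},\bm v^{(2)},\bm v^{(3)}$, let $e_K^{(i)}$ be the edge opposite $\bm v^{(i)}$, with length $l_K^{(i)}$, indexed so that $l_K^{(1)}\ge l_K^{(2)}\ge l_K^{(3)}$; write $l_i=l_K^{(i)}$, $\bm l_K=(l_1,l_2,l_3)^\top$, $\bar l_K=(l_1+l_2+l_3)/3$ and $$\hat l_K=\sqrt{l_1^2+l_2^2+l_3^2-\tfrac23(l_1l_2+l_2l_3+l_3l_1)}.$$ Consider the convex decomposition with edge weights $$w_i=\frac{2l_i}{9\bar l_K+3\hat l_K},\qquad i=1,2,3,$$ and two internal nodes, $s=1,2$, with weights and coordinates $$\omega_s=\frac{\bar l_K+\hat l_K}{6\bar l_K+2\hat l_K},\qquad(\xi_s,\eta_s)^\top=\sum_{i=1}^3\beta_{s,i}\bm v^{(i)},\qquad\beta_{s,i}=\frac{\bm l_K^\top\bm M_{s,i}\bm l_K+2c_{s,i}\hat l_K}{18(\bar l_K+\hat l_K)(l_2+\hat l_K)},$$ where the coefficients $c_{s,i}$ and the symmetric matrices $\bm M_{s,i}$ are the explicit ones listed in the context. This convex decomposition is feasible and optimal for the space $\mathbb P^2$ on $K$.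
   Context: The coefficients are $$\begin{aligned}c_{1,1}&=3l_1+3l_2+\sqrt3l_2-\sqrt3l_3,&c_{1,2}&=6l_2+\sqrt3l_3-\sqrt3l_1,&c_{1,3}&=3l_2+3l_3+\sqrt3l_1-\sqrt3l_2,\\c_{2,1}&=3l_1+3l_2+\sqrt3l_3-\sqrt3l_2,&c_{2,2}&=6l_2+\sqrt3l_1-\sqrt3l_3,&c_{2,3}&=3l_2+3l_3+\sqrt3l_2-\sqrt3l_1,\end{aligned}$$ and the matrices are $$\bm M_{1,1}=\begin{pmatrix}6&1&-2\\1&2\sqrt3+6&-\sqrt3-2\\-2&-\sqrt3-2&6\end{pmatrix},\quad\bm M_{2,1}=\begin{pmatrix}6&1&-2\\1&6-2\sqrt3&\sqrt3-2\\-2&\sqrt3-2&6\end{pmatrix},$$ $$\bm M_{1,2}=\begin{pmatrix}6&-\sqrt3-2&-2\\-\sqrt3-2&12&\sqrt3-2\\-2&\sqrt3-2&6\end{pmatrix},\quad\bm M_{2,2}=\begin{pmatrix}6&\sqrt3-2&-2\\\sqrt3-2&12&-\sqrt3-2\\-2&-\sqrt3-2&6\end{pmatrix},$$ $$\bm M_{1,3}=\begin{pmatrix}6&\sqrt3-2&-2\\\sqrt3-2&6-2\sqrt3&1\\-2&1&6\end{pmatrix},\quad\bm M_{2,3}=\begin{pmatrix}6&-\sqrt3-2&-2\\-\sqrt3-2&2\sqrt3+6&1\\-2&1&6\end{pmatrix}.$$ A convex decomposition of the cell average on a triangle $K$ is an identity of the form $$\frac1{|K|}\iint_Kp\,dx\,dy=\sum_{i=1}^3\frac{w_i}{l_K^{(i)}}\int_{e_K^{(i)}}p\,ds+\sum_{s=1}^S\omega_s\,p(\xi_s,\eta_s).$$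 It is *feasible* for $\mathbb P^k$ (polynomials in $(x,y)$ of total degree at most $k$) if (i) it holds exactly for all $p\in\mathbb P^k$; (ii) the edge weights $w_1,w_2,w_3$ and internal node weights $\omega_1,\dots,\omega_S$ are all positive and sum to one; (iii) all internal nodes $(\xi_s,\eta_s)$ lie in $K$. The number $S\ge0$ of internal nodes is arbitrary. The BP CFL number of a feasible convex decomposition is $\mathcal C_{\rm BP}=\min\{w_1/l_K^{(1)},w_2/l_K^{(2)},w_3/l_K^{(3)}\}$. A feasible convex decomposition for $\mathbb P^k$ on $K$ is *optimal* if no other feasible convex decomposition for $\mathbb P^k$ on $K$ has a strictly larger $\mathcal C_{\rm BP}$. *)

theory Defs
  imports "HOL-Analysis.Analysis"
begin

section \<open>Triangles, edges and polynomial spaces\<close>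

text \<open>
  The vertices of a triangle are given as a family indexed by the three-element numeral type
  \<^typ>\<open>3\<close>, whose elements are \<open>1\<close>, \<open>2\<close> and \<open>3 = 0\<close>. Arithmetic in this type is modulo 3, so
  \<open>v (i + 1)\<close> and \<open>v (i + 2)\<close> are the two vertices other than \<open>v i\<close>.
\<close>

definition triangle :: "(3 \<Rightarrow> real^2) \<Rightarrow> (real^2) set" where
  "triangle v = convex hull (range v)"

definition edge_path :: "(3 \<Rightarrow> real^2) \<Rightarrow> 3 \<Rightarrow> real \<Rightarrow> real^2" where
  "edge_path v i = linepath (v (i + 1)) (v (i + 2))"

lemma edge_paths:
  "edge_path v 1 = linepath (v 2) (v 3)"
  "edge_path v 2 = linepath (v 3) (v 1)"
  "edge_path v 3 = linepath (v 1) (v 2)"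
proof -
  have "(1::3) + 1 = 2" "(1::3) + 2 = 3" "(2::3) + 1 = 3" "(2::3) + 2 = 1"
    "(3::3) + 1 = 1" "(3::3) + 2 = 2"
    by simp_all
  then show "edge_path v 1 = linepath (v 2) (v 3)" "edge_path v 2 = linepath (v 3) (v 1)"
    "edge_path v 3 = linepath (v 1) (v 2)"
    unfolding edge_path_def by metis+
qed

definition edge_lengths :: "(3 \<Rightarrow> real^2) \<Rightarrow> real^3" where
  "edge_lengths v = (\<chi> i. dist (v (i + 1)) (v (i + 2)))"

text \<open>Line integral with respect to arc length along a path parametrised by \<open>[0, 1]\<close>.\<close>

definition arclength_integral :: "(real \<Rightarrow> 'a::euclidean_space) \<Rightarrow> ('a \<Rightarrow> real) \<Rightarrow> real" where
  "arclength_integral g f =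
     integral {0..1} (\<lambda>t. f (g t) * norm (vector_derivative g (at t within {0..1})))"

lemma arclength_integral_edge:
  "arclength_integral (edge_path v i) f =
     edge_lengths v $ i * integral {0..1} (\<lambda>t. f (edge_path v i t))"
proof -
  have "arclength_integral (edge_path v i) f =
      integral {0..1} (\<lambda>t. f (edge_path v i t) * edge_lengths v $ i)"
    unfolding arclength_integral_def
    by (rule integral_cong)
      (simp add: edge_path_def edge_lengths_def vector_derivative_linepath_within
        dist_norm norm_minus_commute)
  then show ?thesis
    by (simp add: mult.commute)
qed

definition poly_space :: "nat \<Rightarrow> (real^2 \<Rightarrow> real) set" where
  "poly_space k =
     {p. \<exists>a :: nat \<Rightarrow> nat \<Rightarrow> real.
           \<forall>z. p z = (\<Sum>i\<le>k. \<Sum>j\<le>k - i. a i j * (z$1) ^ i * (z$2) ^ j)}"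


section \<open>Convex decompositions of the cell average\<close>

text \<open>
  Only the values of \<open>node_weight\<close> and \<open>node\<close> at the indices \<open>1, \<dots>, num_nodes\<close> are meaningful.
\<close>

record decomposition =
  edge_weight :: "3 \<Rightarrow> real"
  num_nodes :: nat
  node_weight :: "nat \<Rightarrow> real"
  node :: "nat \<Rightarrow> real^2"

definition cell_average :: "(3 \<Rightarrow> real^2) \<Rightarrow> (real^2 \<Rightarrow> real) \<Rightarrow> real" where
  "cell_average v p = 1 / measure lborel (triangle v) * integral (triangle v) p"

definition decomposition_sum ::
    "(3 \<Rightarrow> real^2) \<Rightarrow> decomposition \<Rightarrow> (real^2 \<Rightarrow> real) \<Rightarrow> real" where
  "decomposition_sum v D p =
     (\<Sum>i\<in>UNIV. edge_weight D i / edge_lengths v $ i * arclength_integral (edge_path v i) p)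
     + (\<Sum>s=1..num_nodes D. node_weight D s * p (node D s))"

definition feasible :: "nat \<Rightarrow> (3 \<Rightarrow> real^2) \<Rightarrow> decomposition \<Rightarrow> bool" where
  "feasible k v D \<longleftrightarrow>
     (\<forall>p\<in>poly_space k. cell_average v p = decomposition_sum v D p) \<and>
     (\<forall>i. edge_weight D i > 0) \<and>
     (\<forall>s\<in>{1..num_nodes D}. node_weight D s > 0) \<and>
     (\<Sum>i\<in>UNIV. edge_weight D i) + (\<Sum>s=1..num_nodes D. node_weight D s) = 1 \<and>
     (\<forall>s\<in>{1..num_nodes D}. node D s \<in> triangle v)"

definition bp_cfl :: "(3 \<Rightarrow> real^2) \<Rightarrow> decomposition \<Rightarrow> real" where
  "bp_cfl v D = Min (range (\<lambda>i. edge_weight D i / edge_lengths v $ i))"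

definition optimal :: "nat \<Rightarrow> (3 \<Rightarrow> real^2) \<Rightarrow> decomposition \<Rightarrow> bool" where
  "optimal k v D \<longleftrightarrow>
     feasible k v D \<and> \<not> (\<exists>D'. feasible k v D' \<and> bp_cfl v D' > bp_cfl v D)"


section \<open>The explicit decomposition for quadratic polynomials\<close>

definition l_bar :: "real^3 \<Rightarrow> real" where
  "l_bar l = (l$1 + l$2 + l$3) / 3"

definition l_hat :: "real^3 \<Rightarrow> real" where
  "l_hat l = sqrt ((l$1)^2 + (l$2)^2 + (l$3)^2 - 2/3 * (l$1 * l$2 + l$2 * l$3 + l$3 * l$1))"

text \<open>
  In the next two definitions the first index \<open>s\<close> is the number of the internal node, \<open>1\<close> or
  \<open>2\<close> (the \<open>else\<close> branch is the case \<open>s = 2\<close>).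
\<close>

definition c_coeff :: "real^3 \<Rightarrow> nat \<Rightarrow> 3 \<Rightarrow> real" where
  "c_coeff l s i =
     (if s = 1 then
        (vector [3 * l$1 + 3 * l$2 + sqrt 3 * l$2 - sqrt 3 * l$3,
                 6 * l$2 + sqrt 3 * l$3 - sqrt 3 * l$1,
                 3 * l$2 + 3 * l$3 + sqrt 3 * l$1 - sqrt 3 * l$2] :: real^3)
      else
         vector [3 * l$1 + 3 * l$2 + sqrt 3 * l$3 - sqrt 3 * l$2,
                 6 * l$2 + sqrt 3 * l$1 - sqrt 3 * l$3,
                 3 * l$2 + 3 * l$3 + sqrt 3 * l$2 - sqrt 3 * l$1]) $ i"

definition M_mat :: "nat \<Rightarrow> 3 \<Rightarrow> real^3^3" where
  "M_mat s i =
     (if s = 1 then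
        (vector
          [vector [vector [6, 1, -2],
                   vector [1, 2 * sqrt 3 + 6, - sqrt 3 - 2],
                   vector [-2, - sqrt 3 - 2, 6]],
           vector [vector [6, - sqrt 3 - 2, -2],
                   vector [- sqrt 3 - 2, 12, sqrt 3 - 2],
                   vector [-2, sqrt 3 - 2, 6]],
           vector [vector [6, sqrt 3 - 2, -2],
                   vector [sqrt 3 - 2, 6 - 2 * sqrt 3, 1],
                   vector [-2, 1, 6]]] :: real^3^3^3)
      else
        vector
          [vector [vector [6, 1, -2],
                   vector [1, 6 - 2 * sqrt 3, sqrt 3 - 2],
                   vector [-2, sqrt 3 - 2, 6]],
           vector [vector [6, sqrt 3 - 2, -2],
                   vector [sqrt 3 - 2, 12, - sqrt 3 - 2],
                   vector [-2, - sqrt 3 - 2, 6]],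
           vector [vector [6, - sqrt 3 - 2, -2],
                   vector [- sqrt 3 - 2, 2 * sqrt 3 + 6, 1],
                   vector [-2, 1, 6]]]) $ i"

definition beta :: "real^3 \<Rightarrow> nat \<Rightarrow> 3 \<Rightarrow> real" where
  "beta l s i =
     (l \<bullet> (M_mat s i *v l) + 2 * c_coeff l s i * l_hat l)
     / (18 * (l_bar l + l_hat l) * (l$2 + l_hat l))"

definition quadratic_decomposition :: "(3 \<Rightarrow> real^2) \<Rightarrow> decomposition" where
  "quadratic_decomposition v =
     (let l = edge_lengths v in
      \<lparr> edge_weight = (\<lambda>i. 2 * l$i / (9 * l_bar l + 3 * l_hat l)),
        num_nodes = 2,
        node_weight = (\<lambda>s. (l_bar l + l_hat l) / (6 * l_bar l + 2 * l_hat l)),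
        node = (\<lambda>s. \<Sum>i\<in>UNIV. beta l s i *\<^sub>R v i) \<rparr>)"

end

theory Submission
  imports Defs
begin

text \<open>
  The proof treats exactness and optimality separately; both rest on the behaviour of the
  quadrature on products of affine functions.

  \<^emph>\<open>Exactness.\<close> Every quadratic polynomial is a sum of products \<open>f g\<close> of affine functions, and an
  affine function is determined by its values \<open>f\<^sub>i\<close> at the vertices. In these terms the cell average
  is \<open>(\<Sum> f\<^sub>i g\<^sub>i + (\<Sum> f\<^sub>i) (\<Sum> g\<^sub>i)) / 12\<close> (\<open>cell_average_affine_product\<close>), the average over the edge
  joining the vertices \<open>j\<close> and \<open>k\<close> is \<open>(2 f\<^sub>j g\<^sub>j + 2 f\<^sub>k g\<^sub>k + f\<^sub>j g\<^sub>k + f\<^sub>k g\<^sub>j) / 6\<close>, and a node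
  contributes \<open>(\<Sum> \<beta>\<^sub>i f\<^sub>i) (\<Sum> \<beta>\<^sub>i g\<^sub>i)\<close>. What makes the comparison manageable is that the lengthy
  formula for the nodes has a common factor: by the quadratic relation that defines \<open>l_hat\<close>,
  numerator and denominator are divisible by \<open>l\<^sub>2 + l_hat\<close>, which leaves the cyclic expression
  \<open>\<beta>\<^sub>i = (3 (l\<^sub>i + l_hat) \<plusminus> \<surd>3 (l\<^sub>i\<^sub>+\<^sub>1 - l\<^sub>i\<^sub>+\<^sub>2)) / (9 (l_bar + l_hat))\<close> (\<open>beta_simplified\<close>). In
  the sum over the two nodes the terms with \<open>\<surd>3\<close> cancel, and the required equality becomes a
  polynomial identity modulo the relation for \<open>l_hat\<^sup>2\<close> (\<open>quadrature_identity\<close>). The nodes lie in the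
  triangle because \<open>\<surd>3 \<bar>l\<^sub>i\<^sub>+\<^sub>1 - l\<^sub>i\<^sub>+\<^sub>2\<bar> \<le> 3 l\<^sub>i\<close> by the triangle inequality.

  \<^emph>\<open>Optimality.\<close> Let \<open>p\<close> be a nonnegative quadratic polynomial and \<open>A\<close> the sum of its integrals over
  the three edges. Dropping the nodes from a feasible decomposition shows that its CFL number is at
  most \<open>(cell average of p) / A\<close> (\<open>bp_cfl_bound\<close>). All ratios \<open>w\<^sub>i / l\<^sub>i\<close> of the explicit
  decomposition are equal, so it attains this bound as soon as \<open>p\<close> vanishes at both of its nodes.
  Such a \<open>p\<close> is the square of an affine function that vanishes on a line through the two nodes.
\<close>

section \<open>Integration over affine images\<close>

lemma has_derivative_affine_plane:
  fixes a b c :: "real^2"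
  shows "((\<lambda>x. c + x$1 *\<^sub>R a + x$2 *\<^sub>R b) has_derivative
           (\<lambda>x. x$1 *\<^sub>R a + x$2 *\<^sub>R b)) (at x within S)"
  by (auto intro!: derivative_eq_intros bounded_linear.has_derivative[OF bounded_linear_vec_nth])

lemma absolutely_integrable_compact:
  fixes f :: "'a::euclidean_space \<Rightarrow> 'b::euclidean_space"
  assumes "compact S" "continuous_on S f"
  shows "f absolutely_integrable_on S"
  unfolding set_integrable_def
  by (rule integrable_completion[THEN iffD2, OF borel_measurable_integrable])
    (rule borel_integrable_compact[OF assms])+

lemma integrable_on_compact:
  fixes f :: "'a::euclidean_space \<Rightarrow> real"
  assumes "compact S" "continuous_on UNIV f"
  shows "f integrable_on S"
  using absolutely_integrable_compact[OF assms(1) continuous_on_subset[OF assms(2) subset_UNIV]]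
  by (rule absolutely_integrable_on_def[THEN iffD1, THEN conjunct1])

text \<open>
  The scalar integrand is embedded in one-dimensional vectors, the setting of the change of variables
  theorem, and the only component is read off afterwards.
\<close>

lemma integral_affine_image:
  fixes a b c :: "real^2" and f :: "real^2 \<Rightarrow> real"
  assumes S: "compact (S :: (real^2) set)" and f: "continuous_on UNIV f"
    and D: "a$1 * b$2 - a$2 * b$1 \<noteq> 0"
  shows "integral ((\<lambda>x. c + x$1 *\<^sub>R a + x$2 *\<^sub>R b) ` S) f =
     \<bar>a$1 * b$2 - a$2 * b$1\<bar> * integral S (\<lambda>x. f (c + x$1 *\<^sub>R a + x$2 *\<^sub>R b))"
proof -
  define \<phi> :: "real^2 \<Rightarrow> real^2" where "\<phi> = (\<lambda>x. c + x$1 *\<^sub>R a + x$2 *\<^sub>R b)"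
  define \<phi>' :: "real^2 \<Rightarrow> real^2" where "\<phi>' = (\<lambda>x. x$1 *\<^sub>R a + x$2 *\<^sub>R b)"
  let ?D = "a$1 * b$2 - a$2 * b$1"
  let ?F = "\<lambda>z. (\<chi> i. f z) :: real^1"
  have det: "det (matrix \<phi>') = ?D"
    by (simp add: det_2 matrix_def \<phi>'_def axis_def)
  have der: "(\<phi> has_derivative \<phi>') (at x within S)" for x
    unfolding \<phi>_def \<phi>'_def by (rule has_derivative_affine_plane)
  have cont\<phi>: "continuous_on S \<phi>"
    unfolding \<phi>_def by (intro continuous_intros)
  have inj: "inj_on \<phi> S"
  proof (rule inj_onI)
    fix x y assume "\<phi> x = \<phi> y"
    then have "\<forall>i. (x - y)$1 * a$i + (x - y)$2 * b$i = 0"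
      by (simp add: \<phi>_def vec_eq_iff algebra_simps)
    then have 1: "(x - y)$1 * a$1 + (x - y)$2 * b$1 = 0"
      and 2: "(x - y)$1 * a$2 + (x - y)$2 * b$2 = 0" by blast+
    have "(x - y)$1 * ?D = b$2 * ((x - y)$1 * a$1 + (x - y)$2 * b$1) - b$1 * ((x - y)$1 * a$2 + (x - y)$2 * b$2)"
      by (simp add: algebra_simps)
    then have "(x - y)$1 = 0" using 1 2 D by simp
    have "(x - y)$2 * ?D = a$1 * ((x - y)$1 * a$2 + (x - y)$2 * b$2) - a$2 * ((x - y)$1 * a$1 + (x - y)$2 * b$1)"
      by (simp add: algebra_simps)
    then have "(x - y)$2 = 0" using 1 2 D by simp
    with \<open>(x - y)$1 = 0\<close> show "x = y" by (simp add: vec_eq_iff forall_2)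
  qed
  have contF: "continuous_on T ?F" for T
    by (intro continuous_on_vec_lambda continuous_on_subset[OF f]) auto
  have contF\<phi>: "continuous_on S (\<lambda>x. \<bar>?D\<bar> *\<^sub>R ?F (\<phi> x))"
    by (intro continuous_intros continuous_on_compose2[OF contF cont\<phi>]) auto
  have "integral (\<phi> ` S) ?F = integral S (\<lambda>x. \<bar>?D\<bar> *\<^sub>R ?F (\<phi> x))"
    using has_absolute_integral_change_of_variables[OF _ der inj, of ?F "integral S (\<lambda>x. \<bar>?D\<bar> *\<^sub>R ?F (\<phi> x))"]
      absolutely_integrable_compact[OF S contF\<phi>] lmeasurable_compact[OF S]
    by (auto simp: det)
  then have "integral (\<phi> ` S) ?F $ 1 = integral S (\<lambda>x. \<bar>?D\<bar> *\<^sub>R ?F (\<phi> x)) $ 1"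
    by simp
  moreover have "?F integrable_on (\<phi> ` S)" "(\<lambda>x. \<bar>?D\<bar> *\<^sub>R ?F (\<phi> x)) integrable_on S"
    using absolutely_integrable_compact[OF compact_continuous_image[OF cont\<phi> S] contF] absolutely_integrable_compact[OF S contF\<phi>]
    by (auto simp: absolutely_integrable_on_def)
  ultimately have "integral (\<phi> ` S) (\<lambda>z. ?F z $ 1) = integral S (\<lambda>x. (\<bar>?D\<bar> *\<^sub>R ?F (\<phi> x)) $ 1)"
    by (simp only: integral_component_eq_cart)
  then show ?thesis
    by (simp add: \<phi>_def)
qed

section \<open>Second moments of the unit triangle\<close>

definition unit_triangle :: "(real^2) set" where
  "unit_triangle = {x. 0 \<le> x$1 \<and> 0 \<le> x$2 \<and> x$1 + x$2 \<le> 1}"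

lemma compact_unit_triangle: "compact unit_triangle"
proof -
  have "unit_triangle = {x. 0 \<le> x$1} \<inter> {x. 0 \<le> x$2} \<inter> {x. x$1 + x$2 \<le> 1}"
    by (auto simp: unit_triangle_def)
  moreover have "closed \<dots>"
    by (intro closed_Int closed_Collect_le continuous_intros)
  ultimately have "closed unit_triangle" by simp
  moreover have "bounded unit_triangle"
    by (rule boundedI[of _ 2], rule order_trans[OF norm_le_l1_cart])
      (auto simp: unit_triangle_def sum_2)
  ultimately show ?thesis by (simp add: compact_eq_bounded_closed)
qed

text \<open>
  The barycentric coordinates on the unit triangle are \<open>x\<^sub>1\<close>, \<open>x\<^sub>2\<close> and \<open>1 - x\<^sub>1 - x\<^sub>2\<close>. The next two
  lemmas give a transposition and a 3-cycle of them, hence invariance of the integral under all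
  permutations.
\<close>

lemma integral_unit_triangle_swap:
  fixes f :: "real^2 \<Rightarrow> real"
  assumes "continuous_on UNIV f"
  shows "integral unit_triangle f = integral unit_triangle (\<lambda>x. f (vector [x$2, x$1]))"
proof -
  let ?\<phi> = "\<lambda>x::real^2. 0 + x$1 *\<^sub>R vector [0, 1] + x$2 *\<^sub>R vector [1, 0] :: real^2"
  have \<phi>: "?\<phi> x = vector [x$2, x$1]" for x
    by (simp add: vec_eq_iff forall_2)
  have img: "?\<phi> ` unit_triangle = unit_triangle"
  proof
    show "unit_triangle \<subseteq> ?\<phi> ` unit_triangle"
    proof
      fix x assume "x \<in> unit_triangle"
      moreover have "x = ?\<phi> (vector [x$2, x$1])" unfolding \<phi> by (simp add: vec_eq_iff forall_2)
      ultimately show "x \<in> ?\<phi> ` unit_triangle"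
        by (intro image_eqI[of _ _ "vector [x$2, x$1]"]) (auto simp: unit_triangle_def)
    qed
  qed (auto simp: unit_triangle_def)
  then show ?thesis
    using integral_affine_image[OF compact_unit_triangle assms, of "vector [0, 1]" "vector [1, 0]" 0]
    unfolding img \<phi> by simp
qed

lemma integral_unit_triangle_cycle:
  fixes f :: "real^2 \<Rightarrow> real"
  assumes "continuous_on UNIV f"
  shows "integral unit_triangle f = integral unit_triangle (\<lambda>x. f (vector [x$2, 1 - x$1 - x$2]))"
proof -
  let ?\<phi> = "\<lambda>x::real^2. vector [0, 1] + x$1 *\<^sub>R vector [0, -1] + x$2 *\<^sub>R vector [1, -1] :: real^2"
  have \<phi>: "?\<phi> x = vector [x$2, 1 - x$1 - x$2]" for x
    by (simp add: vec_eq_iff forall_2)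
  have img: "?\<phi> ` unit_triangle = unit_triangle"
  proof
    show "unit_triangle \<subseteq> ?\<phi> ` unit_triangle"
    proof
      fix x assume "x \<in> unit_triangle"
      moreover have "x = ?\<phi> (vector [1 - x$1 - x$2, x$1])" unfolding \<phi> by (simp add: vec_eq_iff forall_2)
      ultimately show "x \<in> ?\<phi> ` unit_triangle"
        by (intro image_eqI[of _ _ "vector [1 - x$1 - x$2, x$1]"]) (auto simp: unit_triangle_def)
    qed
  qed (auto simp: unit_triangle_def)
  then show ?thesis
    using integral_affine_image[OF compact_unit_triangle assms, of "vector [0, -1]" "vector [1, -1]" "vector [0, 1]"]
    unfolding img \<phi> by simp
qed

text \<open>
  The median from the origin cuts the unit triangle into two halves that the reflection
  \<open>x\<^sub>1 \<leftrightarrow> x\<^sub>2\<close> exchanges. Each of them is an affine copy of the whole triangle with determinant \<open>1/2\<close>.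
  For a symmetric integrand this turns the integral into itself after a substitution, which is the
  relation that determines the second moments.
\<close>

lemma integral_unit_triangle_bisect:
  fixes f :: "real^2 \<Rightarrow> real"
  assumes f: "continuous_on UNIV f" and sym: "\<And>x. f (vector [x$2, x$1]) = f x"
  shows "integral unit_triangle f = integral unit_triangle (\<lambda>x. f (vector [x$1 + x$2 / 2, x$2 / 2]))"
proof -
  let ?\<phi> = "\<lambda>x::real^2. 0 + x$1 *\<^sub>R vector [1, 0] + x$2 *\<^sub>R vector [1/2, 1/2] :: real^2"
  let ?\<psi> = "\<lambda>x::real^2. 0 + x$1 *\<^sub>R vector [0, 1] + x$2 *\<^sub>R vector [1/2, 1/2] :: real^2"
  have \<phi>: "?\<phi> x = vector [x$1 + x$2 / 2, x$2 / 2]"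
    and \<psi>: "?\<psi> x = vector [x$2 / 2, x$1 + x$2 / 2]" for x
    by (simp add: vec_eq_iff forall_2)+
  have T1: "?\<phi> ` unit_triangle = unit_triangle \<inter> {x. x$2 \<le> x$1}"
  proof
    show "unit_triangle \<inter> {x. x$2 \<le> x$1} \<subseteq> ?\<phi> ` unit_triangle"
    proof
      fix x assume "x \<in> unit_triangle \<inter> {x. x$2 \<le> x$1}"
      moreover have "x = ?\<phi> (vector [x$1 - x$2, 2 * x$2])" unfolding \<phi> by (simp add: vec_eq_iff forall_2)
      ultimately show "x \<in> ?\<phi> ` unit_triangle"
        by (intro image_eqI[of _ _ "vector [x$1 - x$2, 2 * x$2]"]) (auto simp: unit_triangle_def)
    qed
  qed (auto simp: unit_triangle_def)
  have T2: "?\<psi> ` unit_triangle = unit_triangle \<inter> {x. x$1 \<le> x$2}"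
  proof
    show "unit_triangle \<inter> {x. x$1 \<le> x$2} \<subseteq> ?\<psi> ` unit_triangle"
    proof
      fix x assume "x \<in> unit_triangle \<inter> {x. x$1 \<le> x$2}"
      moreover have "x = ?\<psi> (vector [x$2 - x$1, 2 * x$1])" unfolding \<psi> by (simp add: vec_eq_iff forall_2)
      ultimately show "x \<in> ?\<psi> ` unit_triangle"
        by (intro image_eqI[of _ _ "vector [x$2 - x$1, 2 * x$1]"]) (auto simp: unit_triangle_def)
    qed
  qed (auto simp: unit_triangle_def)
  have I1: "integral (unit_triangle \<inter> {x. x$2 \<le> x$1}) f =
      1/2 * integral unit_triangle (\<lambda>x. f (vector [x$1 + x$2 / 2, x$2 / 2]))"
    using integral_affine_image[OF compact_unit_triangle f, of "vector [1, 0]" "vector [1/2, 1/2]" 0]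
    unfolding T1 unfolding \<phi> by simp
  have I2: "integral (unit_triangle \<inter> {x. x$1 \<le> x$2}) f =
      1/2 * integral unit_triangle (\<lambda>x. f (vector [x$2 / 2, x$1 + x$2 / 2]))"
    using integral_affine_image[OF compact_unit_triangle f, of "vector [0, 1]" "vector [1/2, 1/2]" 0]
    unfolding T2 unfolding \<psi> by simp
  have sym': "f (vector [x$2 / 2, x$1 + x$2 / 2]) = f (vector [x$1 + x$2 / 2, x$2 / 2])" for x :: "real^2"
    using sym[of "vector [x$1 + x$2 / 2, x$2 / 2]"] by simp
  have "closed {x::real^2. x$2 \<le> x$1}" "closed {x::real^2. x$1 \<le> x$2}"
    by (intro closed_Collect_le continuous_intros)+
  then have int: "f integrable_on (unit_triangle \<inter> {x. x$2 \<le> x$1})"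
      "f integrable_on (unit_triangle \<inter> {x. x$1 \<le> x$2})"
    by (auto intro!: integrable_on_compact f compact_Int_closed compact_unit_triangle)
  have "negligible {x::real^2. vector [1, -1] \<bullet> x = 0}"
    by (rule negligible_hyperplane) (auto simp: vec_eq_iff forall_2)
  then have neg: "negligible ((unit_triangle \<inter> {x. x$2 \<le> x$1}) \<inter> (unit_triangle \<inter> {x. x$1 \<le> x$2}))"
    by (rule negligible_subset) (auto simp: inner_vec_def sum_2)
  have "unit_triangle = (unit_triangle \<inter> {x. x$2 \<le> x$1}) \<union> (unit_triangle \<inter> {x. x$1 \<le> x$2})"
    by auto
  then have "integral unit_triangle f =
      integral (unit_triangle \<inter> {x. x$2 \<le> x$1}) f + integral (unit_triangle \<inter> {x. x$1 \<le> x$2}) f"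
    using integral_Un[OF int neg] by simp
  then show ?thesis by (simp add: I1 I2 sym')
qed

text \<open>
  By symmetry all squares of barycentric coordinates have the same integral \<open>a\<close> and all products of
  two different ones the same integral \<open>b\<close>. Bisection applied to \<open>x\<^sub>1 x\<^sub>2\<close> gives \<open>b = b/2 + a/4\<close>,
  that is \<open>a = 2 b\<close>. Squaring the equation that the coordinates sum to \<open>1\<close> gives \<open>3 a + 6 b = L 1\<close>.
\<close>

lemma integral_unit_triangle_moments:
  defines "L \<equiv> integral unit_triangle"
  shows "L (\<lambda>x. (x$1)^2) = L (\<lambda>x. 1) / 6" "L (\<lambda>x. (x$2)^2) = L (\<lambda>x. 1) / 6"
    "L (\<lambda>x. (1 - x$1 - x$2)^2) = L (\<lambda>x. 1) / 6"
    "L (\<lambda>x. x$1 * x$2) = L (\<lambda>x. 1) / 12" "L (\<lambda>x. x$1 * (1 - x$1 - x$2)) = L (\<lambda>x. 1) / 12"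
    "L (\<lambda>x. x$2 * (1 - x$1 - x$2)) = L (\<lambda>x. 1) / 12"
proof -
  have int: "h integrable_on unit_triangle" if "continuous_on UNIV h" for h :: "real^2 \<Rightarrow> real"
    by (rule integrable_on_compact[OF compact_unit_triangle that])
  have a1: "L (\<lambda>x. (x$1)^2) = L (\<lambda>x. (x$2)^2)"
    and a2: "L (\<lambda>x. (x$2)^2) = L (\<lambda>x. (1 - x$1 - x$2)^2)"
    and b1: "L (\<lambda>x. x$1 * x$2) = L (\<lambda>x. x$2 * (1 - x$1 - x$2))"
    unfolding L_def by (subst integral_unit_triangle_cycle, intro continuous_intros, simp)+
  have b2: "L (\<lambda>x. x$2 * (1 - x$1 - x$2)) = L (\<lambda>x. x$1 * (1 - x$1 - x$2))"
    unfolding L_def by (subst integral_unit_triangle_swap, intro continuous_intros, simp add: algebra_simps)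
  have "L (\<lambda>x. x$1 * x$2) = L (\<lambda>x. 1/2 * (x$1 * x$2) + 1/4 * (x$2)^2)"
    unfolding L_def
    by (subst integral_unit_triangle_bisect) (auto intro!: continuous_intros simp: algebra_simps power2_eq_square)
  also have "\<dots> = 1/2 * L (\<lambda>x. x$1 * x$2) + 1/4 * L (\<lambda>x. (x$2)^2)"
    unfolding L_def
    by (subst integral_add) (auto intro!: int continuous_intros simp del: integral_mult_right simp: integral_mult_right[symmetric])
  finally have b: "L (\<lambda>x. x$1 * x$2) = L (\<lambda>x. (x$2)^2) / 2" by simp
  have "L (\<lambda>x. 1) = L (\<lambda>x. (x$1)^2 + ((x$2)^2 + ((1 - x$1 - x$2)^2 +
      (2 * (x$1 * x$2) + (2 * (x$1 * (1 - x$1 - x$2)) + 2 * (x$2 * (1 - x$1 - x$2)))))))"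
    by (rule arg_cong[where f=L]) (auto simp: algebra_simps power2_eq_square)
  also have "\<dots> = L (\<lambda>x. (x$1)^2) + (L (\<lambda>x. (x$2)^2) + (L (\<lambda>x. (1 - x$1 - x$2)^2) +
      (2 * L (\<lambda>x. x$1 * x$2) + (2 * L (\<lambda>x. x$1 * (1 - x$1 - x$2)) + 2 * L (\<lambda>x. x$2 * (1 - x$1 - x$2))))))"
    unfolding L_def
    by (subst integral_add integral_mult_right; (intro int continuous_intros)?)+ simp
  finally show "L (\<lambda>x. (x$1)^2) = L (\<lambda>x. 1) / 6" "L (\<lambda>x. (x$2)^2) = L (\<lambda>x. 1) / 6"
    "L (\<lambda>x. (1 - x$1 - x$2)^2) = L (\<lambda>x. 1) / 6"
    "L (\<lambda>x. x$1 * x$2) = L (\<lambda>x. 1) / 12" "L (\<lambda>x. x$1 * (1 - x$1 - x$2)) = L (\<lambda>x. 1) / 12"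
    "L (\<lambda>x. x$2 * (1 - x$1 - x$2)) = L (\<lambda>x. 1) / 12"
    using a1 a2 b1 b2 b by auto
qed


section \<open>The cell average of a product of affine functions\<close>

lemma integral_unit_triangle_pos: "integral unit_triangle (\<lambda>x. 1 :: real) > 0"
proof -
  have "ball (vector [1/4, 1/4]) (1/8) \<subseteq> unit_triangle"
  proof
    fix x :: "real^2" assume "x \<in> ball (vector [1/4, 1/4]) (1/8)"
    then have "norm (vector [1/4, 1/4] - x) < 1/8" by (simp add: dist_norm)
    then have "\<bar>(vector [1/4, 1/4] - x) $ i\<bar> < 1/8" for i
      using component_le_norm_cart[of "vector [1/4, 1/4] - x" i] by linarith
    from this[of 1] this[of 2] have "\<bar>1/4 - x$1\<bar> < 1/8" "\<bar>1/4 - x$2\<bar> < 1/8"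
      by simp_all
    then have "0 \<le> x$1" "0 \<le> x$2" "x$1 + x$2 \<le> 1"
      unfolding abs_less_iff by linarith+
    then show "x \<in> unit_triangle"
      by (simp add: unit_triangle_def)
  qed
  then have "\<not> negligible unit_triangle"
    using negligible_subset open_not_negligible[of "ball (vector [1/4, 1/4] :: real^2) (1/8)"] by auto
  then have "measure lebesgue unit_triangle \<noteq> 0"
    by (simp add: negligible_iff_measure lmeasurable_compact compact_unit_triangle)
  then show ?thesis
    using lmeasure_integral[OF lmeasurable_compact[OF compact_unit_triangle]]
      measure_nonneg[of lebesgue unit_triangle] by linarith
qed

lemma nondegenerate_triangle_det:
  fixes v :: "3 \<Rightarrow> real^2"
  assumes "\<not> collinear (range v)"
  shows "(v 1 - v 3)$1 * (v 2 - v 3)$2 - (v 1 - v 3)$2 * (v 2 - v 3)$1 \<noteq> 0"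
proof
  define a b where "a = v 1 - v 3" and "b = v 2 - v 3"
  assume "(v 1 - v 3)$1 * (v 2 - v 3)$2 - (v 1 - v 3)$2 * (v 2 - v 3)$1 = 0"
  then have D: "a$1 * b$2 = a$2 * b$1" by (simp add: a_def b_def)
  have "range v = {v 1, v 3, v 2}" by (auto simp: UNIV_3)
  then have nc: "\<not> collinear {0, a, b}"
    using assms by (simp add: collinear_3[of "v 1" "v 3" "v 2"] a_def b_def)
  then have "a \<noteq> 0" by (auto simp: collinear_lemma)
  then consider "a$1 \<noteq> 0" | "a$2 \<noteq> 0" by (auto simp: vec_eq_iff forall_2)
  then have "\<exists>c. b = c *\<^sub>R a"
  proof cases
    case 1
    then have "b = (b$1 / a$1) *\<^sub>R a" using D by (simp add: vec_eq_iff forall_2 field_simps)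
    then show ?thesis ..
  next
    case 2
    then have "b = (b$2 / a$2) *\<^sub>R a" using D by (simp add: vec_eq_iff forall_2 field_simps)
    then show ?thesis ..
  qed
  with nc show False by (simp add: collinear_lemma)
qed

text \<open>
  The determinant of the affine map from the unit triangle is a common factor of the integral and of
  the area, and cancels in the average.
\<close>

lemma cell_average_eq_unit_triangle:
  fixes v :: "3 \<Rightarrow> real^2"
  assumes nc: "\<not> collinear (range v)" and f: "continuous_on UNIV f"
  shows "cell_average v f =
     integral unit_triangle (\<lambda>x. f (v 3 + x$1 *\<^sub>R (v 1 - v 3) + x$2 *\<^sub>R (v 2 - v 3)))
     / integral unit_triangle (\<lambda>x. 1)"
proof -
  let ?\<phi> = "\<lambda>x::real^2. v 3 + x$1 *\<^sub>R (v 1 - v 3) + x$2 *\<^sub>R (v 2 - v 3)"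
  let ?D = "(v 1 - v 3)$1 * (v 2 - v 3)$2 - (v 1 - v 3)$2 * (v 2 - v 3)$1"
  have D: "?D \<noteq> 0" by (rule nondegenerate_triangle_det[OF nc])
  have img: "triangle v = ?\<phi> ` unit_triangle"
  proof -
    have "range v = {v 3, v 1, v 2}" by (auto simp: UNIV_3)
    then have tri: "triangle v = {v 3 + s *\<^sub>R (v 1 - v 3) + t *\<^sub>R (v 2 - v 3) | s t. 0 \<le> s \<and> 0 \<le> t \<and> s + t \<le> 1}"
      by (simp add: triangle_def convex_hull_3_alt)
    show ?thesis
    proof
      show "triangle v \<subseteq> ?\<phi> ` unit_triangle"
      proof
        fix z assume "z \<in> triangle v"
        then obtain s t where st: "z = v 3 + s *\<^sub>R (v 1 - v 3) + t *\<^sub>R (v 2 - v 3)" "0 \<le> s" "0 \<le> t" "s + t \<le> 1"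
          unfolding tri by blast
        then have "z = ?\<phi> (vector [s, t])" "vector [s, t] \<in> unit_triangle"
          by (simp_all add: unit_triangle_def)
        then show "z \<in> ?\<phi> ` unit_triangle" by (rule image_eqI)
      qed
      show "?\<phi> ` unit_triangle \<subseteq> triangle v"
        unfolding tri unit_triangle_def by blast
    qed
  qed
  have "compact (triangle v)"
    unfolding triangle_def by (intro compact_convex_hull finite_imp_compact) simp
  then have "measure lborel (triangle v) = integral (triangle v) (\<lambda>x. 1)"
    by (simp add: lmeasure_integral[symmetric] lmeasurable_compact borel_compact)
  then show ?thesis
    unfolding cell_average_def img
    using integral_affine_image[OF compact_unit_triangle f D, of "v 3"]
      integral_affine_image[OF compact_unit_triangle continuous_on_const[of _ 1] D, of "v 3"] D
    by simp
qed

lemma cell_average_add: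
  fixes v :: "3 \<Rightarrow> real^2"
  assumes "\<not> collinear (range v)" "continuous_on UNIV f" "continuous_on UNIV g"
  shows "cell_average v (\<lambda>z. f z + g z) = cell_average v f + cell_average v g"
proof -
  have int: "(\<lambda>x. h (v 3 + x$1 *\<^sub>R (v 1 - v 3) + x$2 *\<^sub>R (v 2 - v 3))) integrable_on unit_triangle"
    if "continuous_on UNIV h" for h :: "real^2 \<Rightarrow> real"
    by (intro integrable_on_compact[OF compact_unit_triangle] continuous_on_compose2[OF that]
        continuous_intros) auto
  show ?thesis
    by (simp add: cell_average_eq_unit_triangle assms continuous_on_add add_divide_distrib
        integral_add int)
qed

definition affine_fun :: "(real^2 \<Rightarrow> real) \<Rightarrow> bool" where
  "affine_fun f \<longleftrightarrow> (\<exists>\<alpha> n. \<forall>z. f z = \<alpha> + n \<bullet> z)"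

lemma affine_fun_continuous: "affine_fun f \<Longrightarrow> continuous_on UNIV f"
  unfolding affine_fun_def fun_eq_iff[symmetric] by (auto intro!: continuous_intros)

lemma affine_fun_combination:
  assumes "affine_fun f" "a + b + c = 1"
  shows "f (a *\<^sub>R x + b *\<^sub>R y + c *\<^sub>R z) = a * f x + b * f y + c * f z"
proof -
  obtain \<alpha> n where f: "\<And>z. f z = \<alpha> + n \<bullet> z" using assms(1) by (auto simp: affine_fun_def)
  have "\<alpha> = (a + b + c) * \<alpha>" by (simp add: assms(2))
  then show ?thesis by (simp add: f inner_add_right algebra_simps)
qed

lemma cell_average_affine_product:
  fixes v :: "3 \<Rightarrow> real^2"
  assumes nc: "\<not> collinear (range v)" and f: "affine_fun f" and g: "affine_fun g"
  shows "cell_average v (\<lambda>z. f z * g z) =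
     (f (v 1) * g (v 1) + f (v 2) * g (v 2) + f (v 3) * g (v 3)
      + (f (v 1) + f (v 2) + f (v 3)) * (g (v 1) + g (v 2) + g (v 3))) / 12"
proof -
  let ?L = "integral unit_triangle :: (real^2 \<Rightarrow> real) \<Rightarrow> real"
  let ?\<phi> = "\<lambda>x::real^2. v 3 + x$1 *\<^sub>R (v 1 - v 3) + x$2 *\<^sub>R (v 2 - v 3)"
  have int: "h integrable_on unit_triangle" if "continuous_on UNIV h" for h :: "real^2 \<Rightarrow> real"
    by (rule integrable_on_compact[OF compact_unit_triangle that])
  have \<phi>: "h (?\<phi> x) = x$1 * h (v 1) + x$2 * h (v 2) + (1 - x$1 - x$2) * h (v 3)" if "affine_fun h" for h x
  proof -
    have "?\<phi> x = x$1 *\<^sub>R v 1 + x$2 *\<^sub>R v 2 + (1 - x$1 - x$2) *\<^sub>R v 3"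
      by (simp add: algebra_simps)
    then show ?thesis using affine_fun_combination[OF that] by simp
  qed
  let ?f1 = "f (v 1)" let ?f2 = "f (v 2)" let ?f3 = "f (v 3)"
  let ?g1 = "g (v 1)" let ?g2 = "g (v 2)" let ?g3 = "g (v 3)"
  have "?L (\<lambda>x. f (?\<phi> x) * g (?\<phi> x)) =
     ?L (\<lambda>x. (?f1 * ?g1) * (x$1)^2 + ((?f2 * ?g2) * (x$2)^2 + ((?f3 * ?g3) * (1 - x$1 - x$2)^2
       + ((?f1 * ?g2 + ?f2 * ?g1) * (x$1 * x$2) + ((?f1 * ?g3 + ?f3 * ?g1) * (x$1 * (1 - x$1 - x$2))
       + (?f2 * ?g3 + ?f3 * ?g2) * (x$2 * (1 - x$1 - x$2)))))))"
    unfolding \<phi>[OF f] \<phi>[OF g]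
    by (rule arg_cong[where f="?L"], rule ext) algebra
  also have "\<dots> = (?f1 * ?g1) * ?L (\<lambda>x. (x$1)^2) + ((?f2 * ?g2) * ?L (\<lambda>x. (x$2)^2)
       + ((?f3 * ?g3) * ?L (\<lambda>x. (1 - x$1 - x$2)^2)
       + ((?f1 * ?g2 + ?f2 * ?g1) * ?L (\<lambda>x. x$1 * x$2)
       + ((?f1 * ?g3 + ?f3 * ?g1) * ?L (\<lambda>x. x$1 * (1 - x$1 - x$2))
       + (?f2 * ?g3 + ?f3 * ?g2) * ?L (\<lambda>x. x$2 * (1 - x$1 - x$2))))))"
    by (subst integral_add integral_mult_right; (intro int continuous_intros)?)+ simp
  also have "\<dots> = ?L (\<lambda>x. 1) * ((?f1 * ?g1 + ?f2 * ?g2 + ?f3 * ?g3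
      + (?f1 + ?f2 + ?f3) * (?g1 + ?g2 + ?g3)) / 12)"
    unfolding integral_unit_triangle_moments by (simp add: field_simps)
  finally show ?thesis
    using integral_unit_triangle_pos
    by (simp add: cell_average_eq_unit_triangle[OF nc] continuous_on_mult affine_fun_continuous f g)
qed

section \<open>Edge integrals and reduction to products\<close>

lemma integral_edge_affine_product:
  assumes f: "affine_fun f" and g: "affine_fun g"
  shows "integral {0..1} (\<lambda>t. f (linepath a b t) * g (linepath a b t)) =
     (2 * f a * g a + 2 * f b * g b + f a * g b + f b * g a) / 6"
proof -
  have *: "h (linepath a b t) = (1 - t) * h a + t * h b" if "affine_fun h" for h t
    using affine_fun_combination[OF that, of "1 - t" t 0 a b 0] by (simp add: linepath_def)
  let ?p = "f a * g a" let ?q = "f a * (g b - g a) + g a * (f b - f a)" let ?r = "(f b - f a) * (g b - g a)"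
  have "((\<lambda>t. ?p + t * ?q + t^2 * ?r) has_integral
      (?p * 1 + 1^2 / 2 * ?q + 1^3 / 3 * ?r) - (?p * 0 + 0^2 / 2 * ?q + 0^3 / 3 * ?r)) {0..1::real}"
    by (rule fundamental_theorem_of_calculus)
      (auto intro!: derivative_eq_intros simp: has_real_derivative_iff_has_vector_derivative[symmetric] power2_eq_square)
  moreover have "(\<lambda>t. f (linepath a b t) * g (linepath a b t)) = (\<lambda>t. ?p + t * ?q + t^2 * ?r)"
    by (rule ext) (simp add: *[OF f] *[OF g] algebra_simps power2_eq_square)
  ultimately have "integral {0..1} (\<lambda>t. f (linepath a b t) * g (linepath a b t)) = ?p + ?q / 2 + ?r / 3"
    by (simp add: integral_unique)
  then show ?thesis by (simp add: field_simps)
qed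

lemma arclength_integral_edge_add:
  assumes "continuous_on UNIV f" "continuous_on UNIV g"
  shows "arclength_integral (edge_path v i) (\<lambda>z. f z + g z) =
    arclength_integral (edge_path v i) f + arclength_integral (edge_path v i) g"
proof -
  have "(\<lambda>t. h (edge_path v i t)) integrable_on {0..1}" if "continuous_on UNIV h" for h :: "real^2 \<Rightarrow> real"
    unfolding edge_path_def
    by (intro integrable_continuous_real continuous_on_compose2[OF that] continuous_on_linepath) auto
  with assms show ?thesis
    by (simp add: arclength_integral_edge integral_add distrib_left)
qed

lemma arclength_integral_edge_nonneg:
  assumes "continuous_on UNIV f" "\<And>z. f z \<ge> 0"
  shows "arclength_integral (edge_path v i) f \<ge> 0"
proof -
  have "(\<lambda>t. f (edge_path v i t)) integrable_on {0..1}"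
    unfolding edge_path_def
    by (intro integrable_continuous_real continuous_on_compose2[OF assms(1)] continuous_on_linepath) auto
  then have "integral {0..1} (\<lambda>t. f (edge_path v i t)) \<ge> 0"
    by (rule integral_nonneg) (simp add: assms(2))
  then show ?thesis by (simp add: arclength_integral_edge edge_lengths_def)
qed

lemma decomposition_sum_add:
  assumes "continuous_on UNIV f" "continuous_on UNIV g"
  shows "decomposition_sum v D (\<lambda>z. f z + g z) = decomposition_sum v D f + decomposition_sum v D g"
  by (simp add: decomposition_sum_def arclength_integral_edge_add[OF assms] distrib_left sum.distrib)

lemma affine_fun_plane: "affine_fun (\<lambda>z. a + b * z$1 + c * z$2)"
  unfolding affine_fun_def
  by (rule exI[of _ a], rule exI[of _ "vector [b, c]"]) (simp add: inner_vec_def sum_2)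

text \<open>
  Sums of three products suffice: pair the part of degree at most one with \<open>1\<close>, the terms divisible by
  \<open>x\<close> with \<open>x\<close>, and the term in \<open>y\<^sup>2\<close> with \<open>y\<close>.
\<close>

lemma quadratic_as_affine_products:
  assumes "p \<in> poly_space 2"
  obtains f1 f2 f3 g1 g2 g3 where
    "affine_fun f1" "affine_fun f2" "affine_fun f3" "affine_fun g1" "affine_fun g2" "affine_fun g3"
    "p = (\<lambda>z. f1 z * g1 z + (f2 z * g2 z + f3 z * g3 z))"
proof -
  obtain a :: "nat \<Rightarrow> nat \<Rightarrow> real"
    where a: "\<And>z. p z = (\<Sum>i\<le>2. \<Sum>j\<le>2 - i. a i j * (z$1) ^ i * (z$2) ^ j)"
    using assms by (auto simp: poly_space_def)
  show ?thesis
  proof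
    show "p = (\<lambda>z. (a 0 0 + a 1 0 * z$1 + a 0 1 * z$2) * (1 + 0 * z$1 + 0 * z$2)
       + ((0 + a 2 0 * z$1 + a 1 1 * z$2) * (0 + 1 * z$1 + 0 * z$2)
       + (0 + 0 * z$1 + a 0 2 * z$2) * (0 + 0 * z$1 + 1 * z$2)))"
      by (rule ext) (simp add: a numeral_2_eq_2 atMost_Suc power2_eq_square algebra_simps)
  qed (rule affine_fun_plane)+
qed

lemma affine_square_in_poly_space:
  assumes "affine_fun f"
  shows "(\<lambda>z. f z * f z) \<in> poly_space 2"
proof -
  obtain \<alpha> n where f: "\<And>z. f z = \<alpha> + n \<bullet> z" using assms by (auto simp: affine_fun_def)
  let ?a = "\<lambda>i j. if i = 0 then (if j = 0 then \<alpha>^2 else if j = Suc 0 then 2 * \<alpha> * n$2 else (n$2)^2)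
     else if i = Suc 0 then (if j = 0 then 2 * \<alpha> * n$1 else 2 * n$1 * n$2) else (n$1)^2"
  have "f z * f z = (\<Sum>i\<le>2. \<Sum>j\<le>2 - i. ?a i j * (z$1) ^ i * (z$2) ^ j)" for z
    by (simp add: f numeral_2_eq_2 atMost_Suc inner_vec_def sum_2 power2_eq_square algebra_simps)
  then show ?thesis
    unfolding poly_space_def by (intro CollectI exI[of _ ?a] allI)
qed

section \<open>The explicit nodes\<close>

lemma l_hat_square:
  "(l_hat l)^2 = (l$1)^2 + (l$2)^2 + (l$3)^2 - 2/3 * (l$1 * l$2 + l$2 * l$3 + l$3 * l$1)"
proof -
  have "(l$1)^2 + (l$2)^2 + (l$3)^2 - 2/3 * (l$1 * l$2 + l$2 * l$3 + l$3 * l$1) =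
     ((l$1)^2 + (l$2)^2 + (l$3)^2 + (l$1 - l$2)^2 + (l$2 - l$3)^2 + (l$3 - l$1)^2) / 3"
    by (simp add: power2_eq_square algebra_simps)
  also have "\<dots> \<ge> 0" by simp
  finally show ?thesis by (simp add: l_hat_def)
qed

lemma l_hat_nonneg: "l_hat l \<ge> 0"
proof -
  have "l_hat l = sqrt ((l_hat l)^2)" by (simp only: l_hat_square) (simp only: l_hat_def)
  then show ?thesis by simp
qed

definition node_sign :: "nat \<Rightarrow> real" where
  "node_sign s = (if s = 1 then sqrt 3 else - sqrt 3)"

text \<open>
  Replacing \<open>l_hat\<^sup>2\<close> by its value shows that the numerator of \<open>beta\<close> is divisible by
  \<open>2 (l\<^sub>2 + l_hat)\<close>. For \<open>i = 1\<close>, for instance, the part free of \<open>\<surd>3\<close> is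
  \<open>6 (l\<^sub>1 + l_hat) (l\<^sub>2 + l_hat)\<close> and the coefficient of \<open>\<surd>3\<close> is \<open>2 (l\<^sub>2 - l\<^sub>3) (l\<^sub>2 + l_hat)\<close>.
\<close>

lemma beta_simplified:
  assumes "l$2 + l_hat l \<noteq> 0"
  shows "beta l s 1 = (3 * (l$1 + l_hat l) + node_sign s * (l$2 - l$3)) / (9 * (l_bar l + l_hat l))"
    and "beta l s 2 = (3 * (l$2 + l_hat l) + node_sign s * (l$3 - l$1)) / (9 * (l_bar l + l_hat l))"
    and "beta l s 3 = (3 * (l$3 + l_hat l) + node_sign s * (l$1 - l$2)) / (9 * (l_bar l + l_hat l))"
proof -
  let ?h = "l_hat l"
  have h2: "3 * (?h * ?h) = 3 * (l$1 * l$1 + l$2 * l$2 + l$3 * l$3) - 2 * (l$1 * l$2 + l$2 * l$3 + l$3 * l$1)"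
    using l_hat_square[of l] by (simp add: power2_eq_square field_simps)
  have num: "l \<bullet> (M_mat s 1 *v l) + 2 * c_coeff l s 1 * ?h
       = (2 * (l$2 + ?h)) * (3 * (l$1 + ?h) + node_sign s * (l$2 - l$3))"
    "l \<bullet> (M_mat s 2 *v l) + 2 * c_coeff l s 2 * ?h
       = (2 * (l$2 + ?h)) * (3 * (l$2 + ?h) + node_sign s * (l$3 - l$1))"
    "l \<bullet> (M_mat s 3 *v l) + 2 * c_coeff l s 3 * ?h
       = (2 * (l$2 + ?h)) * (3 * (l$3 + ?h) + node_sign s * (l$1 - l$2))"
    using h2
    by (simp_all add: M_mat_def c_coeff_def node_sign_def inner_vec_def sum_3
        matrix_vector_mult_def algebra_simps)
  have cancel: "(2 * a) * x / (18 * m * a) = x / (9 * m)" if "a \<noteq> 0" for a m x :: real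
    using that by (cases "m = 0") (simp_all add: divide_simps)
  show "beta l s 1 = (3 * (l$1 + ?h) + node_sign s * (l$2 - l$3)) / (9 * (l_bar l + ?h))"
    "beta l s 2 = (3 * (l$2 + ?h) + node_sign s * (l$3 - l$1)) / (9 * (l_bar l + ?h))"
    "beta l s 3 = (3 * (l$3 + ?h) + node_sign s * (l$1 - l$2)) / (9 * (l_bar l + ?h))"
    unfolding beta_def num by (rule cancel[OF assms])+
qed

lemma edge_lengths_dist:
  "edge_lengths v $ 1 = dist (v 2) (v 3)" "edge_lengths v $ 2 = dist (v 3) (v 1)"
  "edge_lengths v $ 3 = dist (v 1) (v 2)"
proof -
  have "(1::3) + 1 = 2" "(1::3) + 2 = 3" "(2::3) + 1 = 3" "(2::3) + 2 = 1"
    "(3::3) + 1 = 1" "(3::3) + 2 = 2"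
    by simp_all
  then show "edge_lengths v $ 1 = dist (v 2) (v 3)" "edge_lengths v $ 2 = dist (v 3) (v 1)"
    "edge_lengths v $ 3 = dist (v 1) (v 2)"
    unfolding edge_lengths_def by (simp_all only: vec_lambda_beta)
qed

lemma edge_lengths_pos:
  fixes v :: "3 \<Rightarrow> real^2"
  assumes "\<not> collinear (range v)"
  shows "edge_lengths v $ i > 0"
proof -
  have "v 1 \<noteq> v 2" "v 2 \<noteq> v 3" "v 3 \<noteq> v 1"
    using assms by (auto simp: UNIV_3 insert_commute)
  then show ?thesis using exhaust_3[of i] by (auto simp: edge_lengths_dist)
qed

lemma l_bar_pos:
  fixes v :: "3 \<Rightarrow> real^2"
  assumes "\<not> collinear (range v)"
  shows "l_bar (edge_lengths v) > 0"
  using edge_lengths_pos[OF assms] by (simp add: l_bar_def add_pos_pos)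

lemma edge_lengths_triangle:
  "\<bar>edge_lengths v $ 2 - edge_lengths v $ 3\<bar> \<le> edge_lengths v $ 1"
  "\<bar>edge_lengths v $ 3 - edge_lengths v $ 1\<bar> \<le> edge_lengths v $ 2"
  "\<bar>edge_lengths v $ 1 - edge_lengths v $ 2\<bar> \<le> edge_lengths v $ 3"
  using dist_triangle[of "v 1" "v 2" "v 3"] dist_triangle[of "v 2" "v 3" "v 1"]
    dist_triangle[of "v 3" "v 1" "v 2"]
  by (auto simp: edge_lengths_dist dist_commute abs_le_iff)

text \<open>
  Since \<open>\<surd>3 \<le> 3\<close>, the triangle inequality \<open>\<bar>l\<^sub>i\<^sub>+\<^sub>1 - l\<^sub>i\<^sub>+\<^sub>2\<bar> \<le> l\<^sub>i\<close> is more than enough for the linear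
  term to dominate the signed one.
\<close>

lemma beta_nonneg:
  fixes v :: "3 \<Rightarrow> real^2"
  assumes "\<not> collinear (range v)"
  shows "beta (edge_lengths v) s i \<ge> 0"
proof -
  let ?l = "edge_lengths v"
  let ?h = "l_hat ?l"
  have pos: "?l$j > 0" for j by (rule edge_lengths_pos[OF assms])
  have bound: "3 * (a + ?h) + node_sign s * d \<ge> 0" if "\<bar>d\<bar> \<le> a" for a d
  proof -
    have "sqrt 3 \<le> 3" by (rule real_le_lsqrt) auto
    then have "\<bar>node_sign s * d\<bar> \<le> 3 * a"
      using that by (auto simp: node_sign_def abs_mult intro!: mult_mono)
    then have "- (node_sign s * d) \<le> 3 * a" by (rule abs_le_D2)
    then show ?thesis using l_hat_nonneg[of ?l] by (simp add: distrib_left)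
  qed
  have "?l$2 + ?h \<noteq> 0" "l_bar ?l + ?h \<ge> 0"
    using pos[of 1] pos[of 2] pos[of 3] l_hat_nonneg[of ?l] by (auto simp: l_bar_def)
  then show ?thesis
    using exhaust_3[of i] bound edge_lengths_triangle[of v]
    by (auto simp: beta_simplified intro!: divide_nonneg_nonneg)
qed

lemma beta_sum:
  fixes v :: "3 \<Rightarrow> real^2"
  assumes "\<not> collinear (range v)"
  shows "beta (edge_lengths v) s 1 + beta (edge_lengths v) s 2 + beta (edge_lengths v) s 3 = 1"
proof -
  let ?l = "edge_lengths v"
  have "?l$2 + l_hat ?l \<noteq> 0" "l_bar ?l + l_hat ?l > 0"
    using edge_lengths_pos[OF assms, of 1] edge_lengths_pos[OF assms, of 2]
      edge_lengths_pos[OF assms, of 3] l_hat_nonneg[of ?l] by (auto simp: l_bar_def add_pos_nonneg)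
  then show ?thesis
    by (simp add: beta_simplified add_divide_distrib[symmetric])
      (simp add: divide_eq_eq l_bar_def algebra_simps)
qed

section \<open>Feasibility\<close>

text \<open>
  This is exactness on a product of two affine functions with vertex values \<open>f\<^sub>i\<close> and \<open>g\<^sub>i\<close>; \<open>F s\<close> is the
  value at a node, with \<open>s = \<plusminus>\<surd>3\<close> selecting it. Write the numerator of \<open>F s\<close> as \<open>3 X + s D\<close>. In the
  sum over both signs the mixed terms cancel and \<open>s\<^sup>2 = 3\<close> leaves \<open>18 X X' + 6 D D'\<close>. Over the common
  denominator \<open>108 m M\<close> the two sides then differ by a multiple of the relation \<open>h2\<close>.
\<close>

lemma quadrature_identity:
  fixes l1 l2 l3 h :: real
  assumes h2: "h^2 = l1^2 + l2^2 + l3^2 - 2/3 * (l1 * l2 + l2 * l3 + l3 * l1)"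
    and m: "m = (l1 + l2 + l3) / 3 + h" "m \<noteq> 0" and M: "M = l1 + l2 + l3 + h" "M \<noteq> 0"
    and r: "r^2 = 3"
    and F: "\<And>s f1 f2 f3. F s f1 f2 f3 = ((3 * (l1 + h) + s * (l2 - l3)) * f1
      + (3 * (l2 + h) + s * (l3 - l1)) * f2 + (3 * (l3 + h) + s * (l1 - l2)) * f3) / (9 * m)"
  shows "(f1 * g1 + f2 * g2 + f3 * g3 + (f1 + f2 + f3) * (g1 + g2 + g3)) / 12 =
     2 / (3 * M) * (l1 * ((2 * f2 * g2 + 2 * f3 * g3 + f2 * g3 + f3 * g2) / 6)
       + l2 * ((2 * f3 * g3 + 2 * f1 * g1 + f3 * g1 + f1 * g3) / 6)
       + l3 * ((2 * f1 * g1 + 2 * f2 * g2 + f1 * g2 + f2 * g1) / 6))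
     + m / (2 * M) * (F r f1 f2 f3 * F r g1 g2 g3 + F (- r) f1 f2 f3 * F (- r) g1 g2 g3)"
proof -
  let ?X = "\<lambda>f1 f2 f3. (l1 + h) * f1 + (l2 + h) * f2 + (l3 + h) * f3"
  let ?D = "\<lambda>f1 f2 f3. (l2 - l3) * f1 + (l3 - l1) * f2 + (l1 - l2) * f3"
  let ?E = "f1 * g1 + f2 * g2 + f3 * g3" let ?T = "(f1 + f2 + f3) * (g1 + g2 + g3)"
  let ?A = "l1 * (2 * f2 * g2 + 2 * f3 * g3 + f2 * g3 + f3 * g2)
       + l2 * (2 * f3 * g3 + 2 * f1 * g1 + f3 * g1 + f1 * g3)
       + l3 * (2 * f1 * g1 + 2 * f2 * g2 + f1 * g2 + f2 * g1)"
  have F': "F s f1 f2 f3 = (3 * ?X f1 f2 f3 + s * ?D f1 f2 f3) / (9 * m)" for s f1 f2 f3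
    unfolding F by (rule arg_cong[where f="\<lambda>x. x / (9 * m)"]) (simp add: algebra_simps)
  have FF: "(3 * X + r * D) * (3 * Y + r * E) + (3 * X + (- r) * D) * (3 * Y + (- r) * E) = 18 * X * Y + 6 * D * E" for X D Y E
  proof -
    have "(3 * X + r * D) * (3 * Y + r * E) + (3 * X + (- r) * D) * (3 * Y + (- r) * E) = 18 * X * Y + 2 * r^2 * D * E"
      by (simp add: algebra_simps power2_eq_square)
    then show ?thesis by (simp add: r)
  qed
  \<comment> \<open>The cofactor of the relation is found by comparing the coefficients of \<open>h\<^sup>2\<close>.\<close>
  have "9 * m * M * (?E + ?T) - 12 * m * ?A - 4 * (3 * ?X f1 f2 f3 * ?X g1 g2 g3 + ?D f1 f2 f3 * ?D g1 g2 g3)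
     = (h^2 - (l1^2 + l2^2 + l3^2 - 2/3 * (l1 * l2 + l2 * l3 + l3 * l1))) * (9 * ?E - 3 * ?T)"
    unfolding m(1) M(1) by (simp add: field_simps power2_eq_square)
  then have main: "9 * m * M * (?E + ?T) = 12 * m * ?A + 4 * (3 * ?X f1 f2 f3 * ?X g1 g2 g3 + ?D f1 f2 f3 * ?D g1 g2 g3)"
    using h2 by simp
  have nodes: "F r f1 f2 f3 * F r g1 g2 g3 + F (- r) f1 f2 f3 * F (- r) g1 g2 g3
      = (18 * ?X f1 f2 f3 * ?X g1 g2 g3 + 6 * ?D f1 f2 f3 * ?D g1 g2 g3) / (81 * m^2)"
    unfolding F' times_divide_times_eq add_divide_distrib[symmetric] FF by (simp add: power2_eq_square)
  \<comment> \<open>The remaining rewrites bring all three terms over the denominator \<open>108 m M\<close>.\<close>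
  have nodes': "m / (2 * M) * ((18 * X * Y + 6 * D * E) / (81 * m^2)) = 4 * (3 * X * Y + D * E) / (108 * m * M)"
    for X Y D E
    using m(2) M(2) by (simp add: divide_simps power2_eq_square)
  have edges: "2 / (3 * M) * (l1 * (a / 6) + l2 * (b / 6) + l3 * (c / 6)) = 12 * m * (l1 * a + l2 * b + l3 * c) / (108 * m * M)"
    for a b c
    using m(2) M(2) by (simp add: divide_simps)
  have average: "x / 12 = 9 * m * M * x / (108 * m * M)" for x
    using m(2) M(2) by (simp add: divide_simps)
  show ?thesis
    unfolding nodes nodes' edges average main by (rule add_divide_distrib)
qed

lemma quadratic_decomposition_simps:
  fixes v :: "3 \<Rightarrow> real^2"
  defines "l \<equiv> edge_lengths v"
  assumes nc: "\<not> collinear (range v)"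
  shows "edge_weight (quadratic_decomposition v) i / l$i = 2 / (3 * (3 * l_bar l + l_hat l))"
    and "num_nodes (quadratic_decomposition v) = 2"
    and "node_weight (quadratic_decomposition v) s = (l_bar l + l_hat l) / (2 * (3 * l_bar l + l_hat l))"
    and "node (quadratic_decomposition v) s = beta l s 1 *\<^sub>R v 1 + beta l s 2 *\<^sub>R v 2 + beta l s 3 *\<^sub>R v 3"
proof -
  have "l$i > 0" unfolding l_def by (rule edge_lengths_pos[OF nc])
  then show "edge_weight (quadratic_decomposition v) i / l$i = 2 / (3 * (3 * l_bar l + l_hat l))"
    by (simp add: quadratic_decomposition_def l_def[symmetric] Let_def)
qed (simp_all add: quadratic_decomposition_def l_def[symmetric] Let_def sum_3)

lemma quadratic_decomposition_exact_affine_product: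
  fixes v :: "3 \<Rightarrow> real^2"
  assumes nc: "\<not> collinear (range v)" and f: "affine_fun f" and g: "affine_fun g"
  shows "cell_average v (\<lambda>z. f z * g z) = decomposition_sum v (quadratic_decomposition v) (\<lambda>z. f z * g z)"
proof -
  define l where "l = edge_lengths v"
  let ?h = "l_hat l"
  let ?m = "l_bar l + ?h" let ?M = "3 * l_bar l + ?h"
  let ?D = "quadratic_decomposition v"
  let ?F = "\<lambda>s f1 f2 f3. ((3 * (l$1 + ?h) + s * (l$2 - l$3)) * f1
      + (3 * (l$2 + ?h) + s * (l$3 - l$1)) * f2 + (3 * (l$3 + ?h) + s * (l$1 - l$2)) * f3) / (9 * ?m)"
  have pos: "l$i > 0" for i unfolding l_def by (rule edge_lengths_pos[OF nc])
  have nz: "l$2 + ?h \<noteq> 0" "?m \<noteq> 0" "?M \<noteq> 0"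
    using pos[of 2] l_bar_pos[OF nc, folded l_def] l_hat_nonneg[of l] by linarith+
  have node: "k (node ?D s) = ?F (node_sign s) (k (v 1)) (k (v 2)) (k (v 3))" if "affine_fun k" for k s
    unfolding quadratic_decomposition_simps(4)[OF nc, folded l_def]
      affine_fun_combination[OF that beta_sum[OF nc, folded l_def]]
    unfolding beta_simplified[OF nz(1)] by (simp only: add_divide_distrib[symmetric] times_divide_eq_left)
  have "decomposition_sum v ?D (\<lambda>z. f z * g z) =
     2 / (3 * ?M) * (l$1 * ((2 * f (v 2) * g (v 2) + 2 * f (v 3) * g (v 3) + f (v 2) * g (v 3) + f (v 3) * g (v 2)) / 6)
       + l$2 * ((2 * f (v 3) * g (v 3) + 2 * f (v 1) * g (v 1) + f (v 3) * g (v 1) + f (v 1) * g (v 3)) / 6)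
       + l$3 * ((2 * f (v 1) * g (v 1) + 2 * f (v 2) * g (v 2) + f (v 1) * g (v 2) + f (v 2) * g (v 1)) / 6))
     + ?m / (2 * ?M) * (f (node ?D 1) * g (node ?D 1) + f (node ?D 2) * g (node ?D 2))"
    unfolding decomposition_sum_def sum_3 quadratic_decomposition_simps(1-3)[OF nc, folded l_def]
      arclength_integral_edge edge_paths integral_edge_affine_product[OF f g] l_def[symmetric]
    by (simp add: numeral_2_eq_2 distrib_left)
  also have "\<dots> = (f (v 1) * g (v 1) + f (v 2) * g (v 2) + f (v 3) * g (v 3)
      + (f (v 1) + f (v 2) + f (v 3)) * (g (v 1) + g (v 2) + g (v 3))) / 12"
    unfolding node[OF f] node[OF g]
    by (subst quadrature_identity[where F = ?F and r = "sqrt 3" and h = ?h and m = ?m and M = ?M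
          and ?l1.0 = "l$1" and ?l2.0 = "l$2" and ?l3.0 = "l$3"])
      (use nz in \<open>simp_all add: l_hat_square l_bar_def node_sign_def\<close>)
  finally show ?thesis
    by (simp add: cell_average_affine_product[OF nc f g])
qed

lemma quadratic_decomposition_exact:
  fixes v :: "3 \<Rightarrow> real^2"
  assumes nc: "\<not> collinear (range v)" and "p \<in> poly_space 2"
  shows "cell_average v p = decomposition_sum v (quadratic_decomposition v) p"
proof -
  obtain f1 f2 f3 g1 g2 g3
    where aff: "affine_fun f1" "affine_fun f2" "affine_fun f3" "affine_fun g1" "affine_fun g2" "affine_fun g3"
      and p: "p = (\<lambda>z. f1 z * g1 z + (f2 z * g2 z + f3 z * g3 z))"
    using quadratic_as_affine_products[OF assms(2)] .
  note cont = affine_fun_continuous[OF aff(1)] affine_fun_continuous[OF aff(2)]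
    affine_fun_continuous[OF aff(3)] affine_fun_continuous[OF aff(4)]
    affine_fun_continuous[OF aff(5)] affine_fun_continuous[OF aff(6)]
  show ?thesis
    unfolding p
    by (subst cell_average_add[OF nc] decomposition_sum_add; (intro continuous_intros cont)?)+
      (simp add: quadratic_decomposition_exact_affine_product[OF nc] aff)
qed

lemma quadratic_decomposition_feasible:
  fixes v :: "3 \<Rightarrow> real^2"
  assumes nc: "\<not> collinear (range v)"
  shows "feasible 2 v (quadratic_decomposition v)"
proof -
  define l where "l = edge_lengths v"
  let ?D = "quadratic_decomposition v"
  let ?M = "3 * l_bar l + l_hat l"
  note D = quadratic_decomposition_simps[OF nc, folded l_def]
  have pos: "l$i > 0" for i unfolding l_def by (rule edge_lengths_pos[OF nc])
  have m: "l_bar l + l_hat l > 0" and M: "?M > 0"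
    using l_bar_pos[OF nc, folded l_def] l_hat_nonneg[of l] by linarith+
  have w: "edge_weight ?D i = 2 * l$i / (3 * ?M)" for i
    using D(1)[of i] pos[of i] by (simp add: field_simps)
  have weights: "(\<Sum>i\<in>UNIV. edge_weight ?D i) + (\<Sum>s=1..num_nodes ?D. node_weight ?D s) = 1"
  proof -
    have "(\<Sum>i\<in>UNIV. edge_weight ?D i) = 2 * l_bar l / ?M"
      unfolding sum_3 w add_divide_distrib[symmetric] using M by (simp add: l_bar_def divide_simps)
    moreover have "(\<Sum>s=1..num_nodes ?D. node_weight ?D s) = (l_bar l + l_hat l) / ?M"
    proof -
      have half: "2 * (x / (2 * y)) = x / y" for x y :: real by simp
      have "(\<Sum>s=1..num_nodes ?D. node_weight ?D s) = 2 * ((l_bar l + l_hat l) / (2 * ?M))"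
        unfolding D by (simp only: sum_constant) simp
      then show ?thesis unfolding half .
    qed
    ultimately show ?thesis using M by (simp add: add_divide_distrib[symmetric])
  qed
  have "node ?D s \<in> triangle v" for s
  proof -
    have range: "range v = {v 1, v 2, v 3}" by (auto simp: UNIV_3)
    show ?thesis
      using beta_nonneg[OF nc, of s] beta_sum[OF nc, of s]
      unfolding D triangle_def range convex_hull_3 l_def by blast
  qed
  then show ?thesis
    unfolding feasible_def
    using quadratic_decomposition_exact[OF nc] weights pos m M by (auto simp: w D)
qed

section \<open>Optimality\<close>

text \<open>
  The average is at least one twelfth of the sum of the squared vertex values, and an affine function
  that vanishes at three noncollinear points has zero gradient.
\<close>

lemma cell_average_affine_square_pos:
  fixes v :: "3 \<Rightarrow> real^2"
  assumes nc: "\<not> collinear (range v)" and "n \<noteq> 0"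
  shows "cell_average v (\<lambda>z. (n \<bullet> (z - c)) * (n \<bullet> (z - c))) > 0"
proof -
  let ?f = "\<lambda>z. n \<bullet> (z - c)"
  have aff: "affine_fun ?f"
    unfolding affine_fun_def
    by (rule exI[of _ "- (n \<bullet> c)"], rule exI[of _ n]) (simp add: inner_diff_right)
  have "\<not> (?f (v 1) = 0 \<and> ?f (v 2) = 0 \<and> ?f (v 3) = 0)"
  proof
    assume "?f (v 1) = 0 \<and> ?f (v 2) = 0 \<and> ?f (v 3) = 0"
    then have "n \<bullet> (v 1 - v 3) = 0" "n \<bullet> (v 2 - v 3) = 0"
      by (simp_all add: inner_diff_right)
    then have e: "n$1 * (v 1 - v 3)$1 + n$2 * (v 1 - v 3)$2 = 0" "n$1 * (v 2 - v 3)$1 + n$2 * (v 2 - v 3)$2 = 0"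
      by (simp_all add: inner_vec_def sum_2)
    let ?D = "(v 1 - v 3)$1 * (v 2 - v 3)$2 - (v 1 - v 3)$2 * (v 2 - v 3)$1"
    have "n$1 * ?D = 0" "n$2 * ?D = 0" using e by algebra+
    then have "n$1 = 0" "n$2 = 0" using nondegenerate_triangle_det[OF nc] by auto
    then show False using \<open>n \<noteq> 0\<close> by (simp add: vec_eq_iff forall_2)
  qed
  then have a: "0 < ?f (v 1) * ?f (v 1) + ?f (v 2) * ?f (v 2) + ?f (v 3) * ?f (v 3)"
    by (metis add_nonneg_nonneg add_nonneg_eq_0_iff less_le mult_eq_0_iff zero_le_square)
  have b: "(?f (v 1) + ?f (v 2) + ?f (v 3)) * (?f (v 1) + ?f (v 2) + ?f (v 3)) \<ge> 0"
    by simp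
  show ?thesis
    unfolding cell_average_affine_product[OF nc aff aff]
    by (intro divide_pos_pos add_pos_nonneg[OF a b]) simp
qed

text \<open>
  Duality bound: a nonnegative test polynomial limits the CFL number of every feasible decomposition,
  because the nodes contribute nonnegatively and each \<open>w\<^sub>i / l\<^sub>i\<close> is at least the minimum.
\<close>

lemma bp_cfl_bound:
  assumes feas: "feasible k v D" and p: "p \<in> poly_space k" "continuous_on UNIV p" "\<And>z. p z \<ge> 0"
  shows "bp_cfl v D * (\<Sum>i\<in>UNIV. arclength_integral (edge_path v i) p) \<le> cell_average v p"
proof -
  have "bp_cfl v D * (\<Sum>i\<in>UNIV. arclength_integral (edge_path v i) p)
     \<le> (\<Sum>i\<in>UNIV. edge_weight D i / edge_lengths v $ i * arclength_integral (edge_path v i) p)"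
    unfolding sum_distrib_left bp_cfl_def
    by (intro sum_mono mult_right_mono Min_le arclength_integral_edge_nonneg p) auto
  moreover have "(\<Sum>s=1..num_nodes D. node_weight D s * p (node D s)) \<ge> 0"
    using feas p(3) by (intro sum_nonneg) (auto simp: feasible_def less_imp_le)
  ultimately show ?thesis
    using feas p(1) by (simp add: feasible_def decomposition_sum_def)
qed

text \<open>
  The test polynomial is the square of an affine function that vanishes at both nodes. For an
  equilateral triangle the nodes coincide, which is why its gradient \<open>n\<close> is chosen as some nonzero
  vector orthogonal to the difference of the nodes and not as that difference rotated.
\<close>

lemma quadratic_decomposition_optimal:
  fixes v :: "3 \<Rightarrow> real^2"
  assumes nc: "\<not> collinear (range v)"
  shows "optimal 2 v (quadratic_decomposition v)"
proof -
  let ?D = "quadratic_decomposition v"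
  let ?\<kappa> = "2 / (3 * (3 * l_bar (edge_lengths v) + l_hat (edge_lengths v)))"
  have feas: "feasible 2 v ?D" by (rule quadratic_decomposition_feasible[OF nc])
  note D = quadratic_decomposition_simps[OF nc]
  have cfl: "bp_cfl v ?D = ?\<kappa>"
    unfolding bp_cfl_def D by simp
  obtain n :: "real^2" where n: "n \<noteq> 0" "orthogonal (node ?D 2 - node ?D 1) n"
    using orthogonal_to_vector_exists[of "node ?D 2 - node ?D 1"] by auto
  define f where "f z = n \<bullet> (z - node ?D 1)" for z
  let ?p = "\<lambda>z. f z * f z"
  let ?A = "\<Sum>i\<in>UNIV. arclength_integral (edge_path v i) ?p"
  have aff: "affine_fun f"
    unfolding affine_fun_def f_def
    by (rule exI[of _ "- (n \<bullet> node ?D 1)"], rule exI[of _ n]) (simp add: inner_diff_right)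
  have p: "?p \<in> poly_space 2" "continuous_on UNIV ?p" "\<And>z. ?p z \<ge> 0"
    using affine_square_in_poly_space[OF aff] affine_fun_continuous[OF aff]
    by (auto intro!: continuous_intros)
  have "f (node ?D 1) = 0" "f (node ?D 2) = 0"
    using n(2) by (simp_all add: f_def orthogonal_def inner_commute)
  then have "decomposition_sum v ?D ?p = ?\<kappa> * ?A"
    unfolding decomposition_sum_def D sum_distrib_left by (simp add: numeral_2_eq_2)
  then have avg: "cell_average v ?p = ?\<kappa> * ?A"
    using feas p(1) by (simp add: feasible_def)
  moreover have "cell_average v ?p > 0"
    unfolding f_def by (rule cell_average_affine_square_pos[OF nc n(1)])
  moreover have "?A \<ge> 0"
    by (intro sum_nonneg arclength_integral_edge_nonneg p)
  \<comment> \<open>\<open>?A = 0\<close> would make the cell average zero.\<close>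
  ultimately have A: "?A > 0" by (cases "?A = 0") auto
  have "bp_cfl v D' \<le> bp_cfl v ?D" if "feasible 2 v D'" for D'
  proof -
    have "bp_cfl v D' * ?A \<le> ?\<kappa> * ?A"
      using bp_cfl_bound[OF that p] by (simp add: avg)
    then show ?thesis using A by (simp only: cfl mult_le_cancel_right_pos)
  qed
  then show ?thesis
    unfolding optimal_def using feas by (auto simp: not_less)
qed

theorem theorem4p7:
  fixes v :: "3 \<Rightarrow> real^2"
  assumes "\<not> collinear (range v)"
    and "edge_lengths v $ 1 \<ge> edge_lengths v $ 2"
    and "edge_lengths v $ 2 \<ge> edge_lengths v $ 3"
  shows "feasible 2 v (quadratic_decomposition v) \<and> optimal 2 v (quadratic_decomposition v)"
  using quadratic_decomposition_feasible[OF assms(1)] quadratic_decomposition_optimal[OF assms(1)]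
  by simp

end
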